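(* Let $R$ be a commutative ring such that the abelian group $(R,+)$ is torsion-free, and let $\mathcal A$ be a reduced $R$-algebra (associative, not necessarily commutative) that is torsion-free as an $R$-module. Let $D_1,\dots,D_n$ be pairwise commuting $R$-derivations of $\mathcal A$ such that $\mathcal A$ is decomposable with respect to each $D_i$, and put $D=(D_1,\dots,D_n)$. Let $0\neq P(\xi)\in R[\xi]$ be a polynomial in $n$ commutative free variables $\xi=(\xi_1,\dots,\xi_n)$, written as $P(\xi)=\sum_{k=0}^dP_k(\xi)$ with $d\ge 0$ and $P_k(\xi)$ homogeneous of degree $k$. Then the following statements hold: 1) if $P(0)=0$ and the polynomials $P_k(\xi)$ $(1\le k\le d)$ have no nonzero common zeros in $R^n$, then $\mathfrak r(\operatorname{Ker}P(D))\subseteq\mathcal A_0$, where $\mathcal A_0=\bigcap_{i=1}^n\big(\sum_{j=1}^\infty\operatorname{Ker}D_i^j\big)$; 2) if $P(0)\neq 0$, then $\mathfrak r(\operatorname{Ker}P(D))=\{0\}$, and $\operatorname{Ker}P(D)$ is a Mathieu subspace of $\mathcal A$.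
   Context: $\mathcal A$ is reduced if $0$ is its only nilpotent element. "Torsion-free as an $R$-module" means: $ra=0$ with $r\in R$, $a\in\mathcal A$ implies $r=0$ or $a=0$. An $R$-derivation of $\mathcal A$ is an $R$-linear map $\delta$ with $\delta(ab)=\delta(a)b+a\delta(b)$. $\mathcal A$ is decomposable with respect to an $R$-derivation $\delta$ if $\mathcal A=\bigoplus_{\lambda\in H}\mathcal A_\lambda$, where $H\subseteq R$ is the set of all generalized eigenvalues of $\delta$ in $R$ and $\mathcal A_\lambda=\sum_{i=1}^\infty\operatorname{Ker}(\delta-\lambda\mathrm I)^i$, with $\mathrm I$ the identity map of $\mathcal A$. $P(D)$ is the operator on $\mathcal A$ obtained by replacing $\xi_i$ by $D_i$ (constants $c$ become $c\,\mathrm I$). For a subset $V\subseteq\mathcal A$, its radical is $\mathfrak r(V):=\{a\in\mathcal A: a^m\in V\text{ for all sufficiently large }m\}$. An $R$-submodule $V$ of $\mathcal A$ is a Mathieu subspace of $\mathcal A$ if for all $a,b,c\in\mathcal A$ such that $a^m\in V$ for all $m\ge1$, there exists $N$ (depending on $a,b,c$) such that $ba^mc\in V$ for all $m\ge N$. *)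

theory Defs
  imports Complex_Main "HOL-Library.Poly_Mapping"
begin

text \<open>
  The algebra is modelled on a type of class \<open>ring\<close>, so neither commutativity nor a unit is
  required.
\<close>

locale r_algebra = module scale
  for scale :: "'r::comm_ring_1 \<Rightarrow> 'a::ring \<Rightarrow> 'a" +
  assumes scale_mult_left: "scale r (a * b) = scale r a * b"
    and scale_mult_right: "scale r (a * b) = a * scale r b"

text \<open>
  Since there need not be a unit, only positive powers make sense: \<open>ppow a m\<close> is
  the product of \<open>m\<close> copies of \<open>a\<close> for \<open>m \<ge> 1\<close>, and \<open>ppow a 0\<close> is a dummy value.
\<close>

definition ppow :: "'a::ring \<Rightarrow> nat \<Rightarrow> 'a" where
  "ppow a m = (((*) a) ^^ (m - 1)) a"

lemma ppow_1: "ppow a 1 = a"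
  by (simp add: ppow_def)

lemma ppow_Suc: "m \<ge> 1 \<Longrightarrow> ppow a (Suc m) = a * ppow a m"
  by (cases m) (simp_all add: ppow_def)

lemma ppow_eq_power:
  fixes a :: "'a::ring_1"
  assumes "m \<ge> 1"
  shows "ppow a m = a ^ m"
  using assms by (induction m rule: dec_induct) (simp_all add: ppow_1 ppow_Suc flip: One_nat_def)

definition reduced :: "'a::ring itself \<Rightarrow> bool" where
  "reduced _ \<longleftrightarrow> (\<forall>a::'a. (\<exists>m\<ge>1. ppow a m = 0) \<longrightarrow> a = 0)"

definition torsion_free_group :: "'r::comm_ring_1 itself \<Rightarrow> bool" where
  "torsion_free_group _ \<longleftrightarrow> (\<forall>(k::nat) (r::'r). of_nat k * r = 0 \<longrightarrow> k = 0 \<or> r = 0)"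

definition torsion_free_module :: "('r::comm_ring_1 \<Rightarrow> 'a::ab_group_add \<Rightarrow> 'a) \<Rightarrow> bool" where
  "torsion_free_module scale \<longleftrightarrow> (\<forall>r a. scale r a = 0 \<longrightarrow> r = 0 \<or> a = 0)"

definition derivation :: "('r::comm_ring_1 \<Rightarrow> 'a::ring \<Rightarrow> 'a) \<Rightarrow> ('a \<Rightarrow> 'a) \<Rightarrow> bool" where
  "derivation scale \<delta> \<longleftrightarrow>
    module_hom scale scale \<delta> \<and> (\<forall>a b. \<delta> (a * b) = \<delta> a * b + a * \<delta> b)"

definition Ker :: "('a \<Rightarrow> 'a::zero) \<Rightarrow> 'a set" where
  "Ker f = {a. f a = 0}"

text \<open>The sum of a family of submodules is the span of their union.\<close>

definition sum_Ker_powers ::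
    "('r::comm_ring_1 \<Rightarrow> 'a::ab_group_add \<Rightarrow> 'a) \<Rightarrow> ('a \<Rightarrow> 'a) \<Rightarrow> 'a set" where
  "sum_Ker_powers scale f = module.span scale (\<Union>i\<in>{1..}. Ker (f ^^ i))"

definition gen_eigenspace ::
    "('r::comm_ring_1 \<Rightarrow> 'a::ab_group_add \<Rightarrow> 'a) \<Rightarrow> ('a \<Rightarrow> 'a) \<Rightarrow> 'r \<Rightarrow> 'a set" where
  "gen_eigenspace scale \<delta> l = sum_Ker_powers scale (\<lambda>a. \<delta> a - scale l a)"

definition gen_eigenvalues ::
    "('r::comm_ring_1 \<Rightarrow> 'a::ab_group_add \<Rightarrow> 'a) \<Rightarrow> ('a \<Rightarrow> 'a) \<Rightarrow> 'r set" where
  "gen_eigenvalues scale \<delta> =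
    {l. \<exists>a i. a \<noteq> 0 \<and> i \<ge> 1 \<and> a \<in> Ker ((\<lambda>a. \<delta> a - scale l a) ^^ i)}"

text \<open>
  Internal direct sum: every element is, in exactly one way, a finitely supported
  sum of components taken from the summands.
\<close>

definition is_direct_sum :: "'i set \<Rightarrow> ('i \<Rightarrow> 'a::comm_monoid_add set) \<Rightarrow> bool" where
  "is_direct_sum H M \<longleftrightarrow>
    (\<forall>a. \<exists>!f. finite {l. f l \<noteq> 0} \<and> (\<forall>l\<in>H. f l \<in> M l) \<and> (\<forall>l. l \<notin> H \<longrightarrow> f l = 0) \<and>
      a = (\<Sum>l\<in>{l. f l \<noteq> 0}. f l))"

definition decomposable ::
    "('r::comm_ring_1 \<Rightarrow> 'a::ab_group_add \<Rightarrow> 'a) \<Rightarrow> ('a \<Rightarrow> 'a) \<Rightarrow> bool" where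
  "decomposable scale \<delta> \<longleftrightarrow>
    is_direct_sum (gen_eigenvalues scale \<delta>) (gen_eigenspace scale \<delta>)"

text \<open>
  Polynomials are finitely supported maps from exponent vectors to coefficients;
  the variables are indexed by natural numbers, and \<open>polys n\<close> consists of the
  polynomials in the variables with indices \<open>0, \<dots>, n - 1\<close>.
\<close>

type_synonym 'r mpoly = "(nat \<Rightarrow>\<^sub>0 nat) \<Rightarrow>\<^sub>0 'r"

definition polys :: "nat \<Rightarrow> 'r::zero mpoly set" where
  "polys n = {P. \<forall>m\<in>Poly_Mapping.keys P. Poly_Mapping.keys m \<subseteq> {..<n}}"

definition homogeneous :: "nat \<Rightarrow> 'r::zero mpoly \<Rightarrow> bool" where
  "homogeneous k P \<longleftrightarrow>
    (\<forall>m\<in>Poly_Mapping.keys P. (\<Sum>i\<in>Poly_Mapping.keys m. Poly_Mapping.lookup m i) = k)"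

definition peval :: "'r::comm_ring_1 mpoly \<Rightarrow> (nat \<Rightarrow> 'r) \<Rightarrow> 'r" where
  "peval P x = (\<Sum>m\<in>Poly_Mapping.keys P. Poly_Mapping.lookup P m *
    (\<Prod>i\<in>Poly_Mapping.keys m. x i ^ Poly_Mapping.lookup m i))"

text \<open>
  \<open>P(D)\<close> for \<open>P \<in> polys n\<close>. The monomial operator is the composite of the powers of
  \<open>D 0, \<dots>, D (n - 1)\<close> in this order; the order is irrelevant for commuting \<open>D i\<close>.
\<close>

definition diff_op ::
    "('r::comm_ring_1 \<Rightarrow> 'a::ab_group_add \<Rightarrow> 'a) \<Rightarrow> nat \<Rightarrow> 'r mpoly \<Rightarrow> (nat \<Rightarrow> 'a \<Rightarrow> 'a) \<Rightarrow> 'a \<Rightarrow> 'a" where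
  "diff_op scale n P D a = (\<Sum>m\<in>Poly_Mapping.keys P. scale (Poly_Mapping.lookup P m)
    (foldr (\<lambda>i. D i ^^ Poly_Mapping.lookup m i) [0..<n] a))"

definition radical :: "'a::ring set \<Rightarrow> 'a set" where
  "radical V = {a. \<exists>N. \<forall>m\<ge>N. ppow a m \<in> V}"

definition mathieu_subspace :: "('r::comm_ring_1 \<Rightarrow> 'a::ring \<Rightarrow> 'a) \<Rightarrow> 'a set \<Rightarrow> bool" where
  "mathieu_subspace scale V \<longleftrightarrow> module.subspace scale V \<and>
    (\<forall>a b c. (\<forall>m\<ge>1. ppow a m \<in> V) \<longrightarrow> (\<exists>N. \<forall>m\<ge>N. b * ppow a m * c \<in> V))"

end

theory Submission
  imports Defs "HOL-Library.Function_Algebras"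
begin

text \<open>
  The joint generalized eigenspaces of the \<open>D i\<close> form a grading of the algebra by \<open>R\<^sup>n\<close>,
  and \<open>P(D)\<close> preserves each component. Order the torsion-free group \<open>R\<^sup>n\<close> totally, and let
  \<open>w\<close> be the greatest or least element of the support of \<open>a\<close>. Then the component of
  \<open>a\<^sup>m\<close> of degree \<open>m w\<close> is the \<open>m\<close>-th power of the component of \<open>a\<close> of degree \<open>w\<close>,
  which is nonzero since the algebra is reduced. If \<open>P(D)\<close> annihilates \<open>a\<^sup>m\<close>, it annihilates
  this power, hence also some joint eigenvector of the same degree, so \<open>P(m w) = 0\<close>.
  If this holds for all large \<open>m\<close>, then every homogeneous component of \<open>P\<close> vanishes at \<open>w\<close>.
\<close>

subsection \<open>Total orders on torsion-free groups\<close>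

text \<open>The set of nonnegative elements of a translation-invariant partial order, in which
  \<open>x\<close> is at most \<open>y\<close> when \<open>y - x\<close> lies in
  \<open>C\<close>.\<close>

definition pointed_cone :: "'g::ab_group_add set \<Rightarrow> bool" where
  "pointed_cone C \<longleftrightarrow> 0 \<in> C \<and> (\<forall>x\<in>C. \<forall>y\<in>C. x + y \<in> C) \<and> (\<forall>x. x \<in> C \<and> - x \<in> C \<longrightarrow> x = 0)"

lemma pointed_coneD:
  assumes "pointed_cone C"
  shows "0 \<in> C" "\<And>x y. x \<in> C \<Longrightarrow> y \<in> C \<Longrightarrow> x + y \<in> C" "\<And>x. x \<in> C \<Longrightarrow> - x \<in> C \<Longrightarrow> x = 0"
  using assms unfolding pointed_cone_def by blast+

lemma pointed_cone_of_nat_mult: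
  fixes C :: "'g::comm_ring_1 set"
  assumes "pointed_cone C" "x \<in> C"
  shows "of_nat k * x \<in> C"
  by (induction k) (simp_all add: pointed_coneD[OF assms(1)] assms(2) distrib_right)

text \<open>By maximality the submonoid \<open>X\<close> generated by \<open>C\<close> and
  \<open>x\<close> is not pointed. Adding the representations of a nonzero \<open>y\<close> and of
  \<open>- y\<close> in \<open>X\<close> gives a relation that puts a negative multiple of
  \<open>x\<close> in \<open>C\<close>.\<close>

lemma maximal_cone_negative_multiple:
  fixes C :: "'g::comm_ring_1 set"
  assumes C: "pointed_cone C" and max: "\<And>X. pointed_cone X \<Longrightarrow> C \<subseteq> X \<Longrightarrow> X = C" and x: "x \<notin> C"
  shows "\<exists>p>0. - (of_nat p * x) \<in> C"
proof -
  note [simp] = pointed_coneD(1,2)[OF C]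
  define X where "X = {c + of_nat k * x |c k. c \<in> C}"
  have "C \<subseteq> X"
  proof
    fix c assume "c \<in> C"
    then show "c \<in> X" unfolding X_def by (auto intro!: exI[of _ c] exI[of _ "0::nat"])
  qed
  moreover have "x \<in> X"
    unfolding X_def by (auto intro!: exI[of _ "0::'g"] exI[of _ "1::nat"])
  ultimately have "\<not> pointed_cone X" using max x by blast
  moreover have "0 \<in> X" using \<open>C \<subseteq> X\<close> by auto
  moreover have "y + z \<in> X" if "y \<in> X" "z \<in> X" for y z
  proof -
    from that obtain c k c' k' where *: "c \<in> C" "c' \<in> C" "y = c + of_nat k * x" "z = c' + of_nat k' * x"
      unfolding X_def by blast
    then have "y + z = (c + c') + of_nat (k + k') * x" by (simp add: algebra_simps)
    with * show ?thesis unfolding X_def by (auto intro!: exI[of _ "c + c'"] exI[of _ "k + k'"])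
  qed
  ultimately obtain y where y: "y \<in> X" "- y \<in> X" "y \<noteq> 0" unfolding pointed_cone_def by blast
  then obtain c k c' k' where *: "c \<in> C" "c' \<in> C" "y = c + of_nat k * x" "- y = c' + of_nat k' * x"
    unfolding X_def by blast
  have "y + - y = (c + c') + of_nat (k + k') * x" unfolding *(3,4) using * by (simp add: algebra_simps)
  then have eq: "- (of_nat (k + k') * x) = c + c'" by (simp add: add_eq_0_iff)
  \<comment> \<open>If \<open>k\<close> and \<open>k'\<close> were both 0, then \<open>y\<close> and
    \<open>- y\<close> would lie in the pointed cone \<open>C\<close>.\<close>
  have "k + k' > 0"
  proof (rule ccontr)
    assume "\<not> k + k' > 0"
    then have "k = 0" "c' = - c" using eq * by (auto simp: add_eq_0_iff)
    then show False using * y pointed_coneD(3)[OF C, of c] by auto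
  qed
  with eq * show ?thesis by (intro exI[of _ "k + k'"]) auto
qed

text \<open>Zorn's lemma gives a maximal pointed cone. If it missed both \<open>x\<close> and
  \<open>- x\<close>, it would contain \<open>- p x\<close> and \<open>q x\<close> for some positive
  \<open>p\<close> and \<open>q\<close>, hence \<open>p q x\<close> and its negative. Then
  \<open>p q x = 0\<close>, so \<open>x = 0\<close> by torsion-freeness, but 0 lies in the
  cone.\<close>

lemma total_cone_exists:
  assumes tf: "torsion_free_group TYPE('g::comm_ring_1)"
  shows "\<exists>C::'g set. pointed_cone C \<and> (\<forall>x. x \<in> C \<or> - x \<in> C)"
proof -
  have "\<exists>M\<in>Collect pointed_cone. \<forall>X\<in>Collect pointed_cone. M \<subseteq> X \<longrightarrow> X = (M::'g set)"
  proof (rule subset_Zorn_nonempty)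
    have "pointed_cone {0::'g}" by (simp add: pointed_cone_def)
    then show "Collect pointed_cone \<noteq> ({} :: 'g set set)" by blast
  next
    fix \<C> :: "'g set set"
    assume ne: "\<C> \<noteq> {}" and ch: "subset.chain (Collect pointed_cone) \<C>"
    have pc: "\<And>X. X \<in> \<C> \<Longrightarrow> pointed_cone X" using ch unfolding subset.chain_def by blast
    have common: "\<exists>X\<in>\<C>. x \<in> X \<and> y \<in> X" if "x \<in> \<Union>\<C>" "y \<in> \<Union>\<C>" for x y
      using that ch unfolding subset.chain_def by blast
    have "0 \<in> \<Union>\<C>" using ne pc pointed_coneD(1) by blast
    moreover have "x + y \<in> \<Union>\<C>" if "x \<in> \<Union>\<C>" "y \<in> \<Union>\<C>" for x y
      using common[OF that] pc pointed_coneD(2) by blast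
    moreover have "x = 0" if "x \<in> \<Union>\<C>" "- x \<in> \<Union>\<C>" for x
      using common[OF that] pc pointed_coneD(3) by blast
    ultimately show "\<Union>\<C> \<in> Collect pointed_cone" unfolding pointed_cone_def by blast
  qed
  then obtain C :: "'g set" where C: "pointed_cone C"
    and max: "\<And>X. pointed_cone X \<Longrightarrow> C \<subseteq> X \<Longrightarrow> X = C" by blast
  have "x \<in> C \<or> - x \<in> C" for x
  proof (rule ccontr)
    assume "\<not> (x \<in> C \<or> - x \<in> C)"
    then have nx: "x \<notin> C" "- x \<notin> C" by auto
    obtain p where p: "p > 0" "- (of_nat p * x) \<in> C"
      using maximal_cone_negative_multiple[OF C max nx(1)] by blast
    obtain q where q: "q > 0" "of_nat q * x \<in> C"
      using maximal_cone_negative_multiple[OF C max nx(2)] by auto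
    have "of_nat p * (of_nat q * x) \<in> C" "of_nat q * - (of_nat p * x) \<in> C"
      using p q pointed_cone_of_nat_mult[OF C] by blast+
    then have "of_nat (p * q) * x = 0"
      by (intro pointed_coneD(3)[OF C]) (simp_all add: mult_ac)
    then have "x = 0" using tf p q unfolding torsion_free_group_def
      by (metis mult_is_0 not_gr_zero)
    then show False using nx pointed_coneD(1)[OF C] by simp
  qed
  with C show ?thesis by blast
qed

text \<open>Weights will be functions into \<open>'r\<close> with pointwise operations, where
  \<open>of_nat m * w\<close> is the \<open>m\<close>-fold multiple of \<open>w\<close>; this makes
  \<open>total_cone_exists\<close> applicable to them.\<close>

lemma torsion_free_group_fun:
  assumes "torsion_free_group TYPE('r::comm_ring_1)"
  shows "torsion_free_group TYPE('i \<Rightarrow> 'r)"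
  using assms by (auto simp: torsion_free_group_def fun_eq_iff)

text \<open>\<open>m\<close> is the greatest element of \<open>S\<close> for the total order defined
  by \<open>C\<close>; an inserted element either lies below the old maximum or, by totality,
  replaces it.\<close>

lemma cone_max_exists:
  assumes C: "pointed_cone C" and tot: "\<forall>x. x \<in> C \<or> - x \<in> C" and "finite S" "S \<noteq> {}"
  shows "\<exists>m\<in>S. \<forall>x\<in>S. m - x \<in> C"
  using assms(3,4)
proof (induction rule: finite_ne_induct)
  case (singleton x)
  then show ?case using pointed_coneD(1)[OF C] by simp
next
  case (insert x S)
  then obtain m where m: "m \<in> S" "\<forall>y\<in>S. m - y \<in> C" by blast
  show ?case
  proof (cases "m - x \<in> C")
    case True
    then show ?thesis using m by auto
  next
    case False
    then have xm: "x - m \<in> C" using tot[rule_format, of "m - x"] by simp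
    have "x - y \<in> C" if "y \<in> S" for y
      using pointed_coneD(2)[OF C xm, of "m - y"] m that by simp
    then show ?thesis using pointed_coneD(1)[OF C] by auto
  qed
qed

subsection \<open>Evaluation of polynomials\<close>

text \<open>Replacing \<open>f m\<close> by \<open>f (2 * m) - 2 ^ d * f m\<close> eliminates the top coefficient.\<close>

lemma nat_polynomial_zero_coeffs:
  fixes c :: "nat \<Rightarrow> 'r::comm_ring_1"
  assumes tf: "torsion_free_group TYPE('r)"
    and "\<And>m. m \<ge> N \<Longrightarrow> (\<Sum>k\<le>d. of_nat m ^ k * c k) = 0"
  shows "k \<le> d \<Longrightarrow> c k = 0"
  using assms(2)
proof (induction d arbitrary: c k)
  case 0
  then show ?case by auto
next
  case (Suc d)
  have low: "c j = 0" if "j \<le> d" for j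
  proof -
    define b where "b j = (2 ^ j - 2 ^ Suc d) * c j" for j
    have "(\<Sum>j\<le>d. of_nat m ^ j * b j) = 0" if "m \<ge> N" for m
    proof -
      have "(\<Sum>j\<le>d. of_nat m ^ j * b j) = (\<Sum>j\<le>Suc d. of_nat m ^ j * b j)"
        by (simp add: b_def)
      also have "\<dots> = (\<Sum>j\<le>Suc d. of_nat (2 * m) ^ j * c j)
          - 2 ^ Suc d * (\<Sum>j\<le>Suc d. of_nat m ^ j * c j)"
        unfolding sum_distrib_left sum_subtractf[symmetric] b_def
        by (intro sum.cong refl) (simp add: algebra_simps power_mult_distrib del: power_Suc)
      finally show ?thesis using Suc.prems(2)[of m] Suc.prems(2)[of "2 * m"] that by simp
    qed
    then have "b j = 0" using Suc.IH \<open>j \<le> d\<close> by blast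
    \<comment> \<open>Torsion-freeness speaks of natural multiples, so the factor is rewritten as
      minus a positive natural number.\<close>
    then have "- (of_nat (2 ^ Suc d - 2 ^ j) * c j) = 0"
      using \<open>j \<le> d\<close> by (subst of_nat_diff) (simp_all add: b_def algebra_simps del: power_Suc)
    moreover have "(2::nat) ^ Suc d - 2 ^ j \<noteq> 0" using \<open>j \<le> d\<close>
      by (metis diff_is_0_eq le_imp_less_Suc not_le one_less_numeral_iff power_strict_increasing_iff semiring_norm(76))
    ultimately show ?thesis using tf unfolding torsion_free_group_def by (metis neg_equal_0_iff_equal)
  qed
  \<comment> \<open>At \<open>Suc N\<close>, which is at least \<open>N\<close> and nonzero, only
    the top term remains.\<close>
  have "of_nat (Suc N ^ Suc d) * c (Suc d) = 0"
    using Suc.prems(2)[of "Suc N"] low by (simp del: power_Suc of_nat_Suc)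
  then have "c (Suc d) = 0" using tf unfolding torsion_free_group_def by (metis nat.distinct(1) power_not_zero)
  with low show ?case using Suc.prems(1) by (metis le_SucE)
qed

lemma peval_superset:
  assumes "finite A" "Poly_Mapping.keys P \<subseteq> A"
  shows "peval P x = (\<Sum>m\<in>A. Poly_Mapping.lookup P m *
    (\<Prod>i\<in>Poly_Mapping.keys m. x i ^ Poly_Mapping.lookup m i))"
  unfolding peval_def using assms
  by (intro sum.mono_neutral_left) (auto simp: in_keys_iff)

lemma peval_zero [simp]: "peval 0 x = 0"
  by (simp add: peval_def)

lemma peval_add: "peval (P + Q) x = peval P x + peval Q x"
proof -
  have fin: "finite (Poly_Mapping.keys P \<union> Poly_Mapping.keys Q)" by simp
  show ?thesis
    using Poly_Mapping.keys_add[of P Q]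
    by (simp add: peval_superset[OF fin] lookup_add distrib_right sum.distrib)
qed

lemma peval_sum: "peval (\<Sum>k\<in>K. Q k) x = (\<Sum>k\<in>K. peval (Q k) x)"
  by (induction K rule: infinite_finite_induct) (simp_all add: peval_add)

lemma peval_homogeneous:
  assumes "homogeneous k Q"
  shows "peval Q (of_nat m * x) = of_nat m ^ k * peval Q x"
  unfolding peval_def sum_distrib_left
proof (intro sum.cong refl)
  fix e assume "e \<in> Poly_Mapping.keys Q"
  then have "(\<Sum>i\<in>Poly_Mapping.keys e. Poly_Mapping.lookup e i) = k"
    using assms by (simp add: homogeneous_def)
  then show "Poly_Mapping.lookup Q e * (\<Prod>i\<in>Poly_Mapping.keys e. (of_nat m * x) i ^ Poly_Mapping.lookup e i)
    = of_nat m ^ k * (Poly_Mapping.lookup Q e * (\<Prod>i\<in>Poly_Mapping.keys e. x i ^ Poly_Mapping.lookup e i))"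
    by (simp add: power_mult_distrib prod.distrib mult_ac flip: power_sum)
qed

text \<open>A product over all \<open>n\<close> variables matches the monomial operators in
  \<open>diff_op\<close>; absent variables contribute the factor 1.\<close>

lemma peval_polys:
  assumes "P \<in> polys n"
  shows "peval P x = (\<Sum>m\<in>Poly_Mapping.keys P. Poly_Mapping.lookup P m *
    (\<Prod>i<n. x i ^ Poly_Mapping.lookup m i))"
  unfolding peval_def
proof (intro sum.cong refl arg_cong2[where f = "(*)"] prod.mono_neutral_left ballI)
  fix m assume "m \<in> Poly_Mapping.keys P"
  then show "Poly_Mapping.keys m \<subseteq> {..<n}" using assms by (auto simp: polys_def)
qed (auto simp: in_keys_iff)

text \<open>By homogeneity, along the multiples of \<open>x\<close> the polynomial becomes a
  polynomial in \<open>m\<close> with coefficients \<open>peval (Pk k) x\<close>.\<close>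

lemma peval_eventually_zero_components:
  fixes Pk :: "nat \<Rightarrow> 'r::comm_ring_1 mpoly"
  assumes tf: "torsion_free_group TYPE('r)" and hom: "\<And>k. k \<le> d \<Longrightarrow> homogeneous k (Pk k)"
    and zero: "\<And>m. m \<ge> N \<Longrightarrow> peval (\<Sum>k\<le>d. Pk k) (of_nat m * x) = 0" and "k \<le> d"
  shows "peval (Pk k) x = 0"
proof (rule nat_polynomial_zero_coeffs[OF tf _ \<open>k \<le> d\<close>])
  fix m assume "m \<ge> N"
  show "(\<Sum>k\<le>d. of_nat m ^ k * peval (Pk k) x) = 0"
    using zero[OF \<open>m \<ge> N\<close>] by (simp add: peval_sum peval_homogeneous[OF hom])
qed

text \<open>Scaling \<open>x\<close> by 0 removes every component of positive degree.
  \<open>Pk 0\<close> is constant, so any \<open>x\<close> may stand on the right.\<close>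

lemma peval_at_zero:
  assumes hom: "\<And>k. k \<le> d \<Longrightarrow> homogeneous k (Pk k)"
  shows "peval (\<Sum>k\<le>d. Pk k) (\<lambda>_. 0) = peval (Pk 0) x"
proof -
  have "(\<lambda>_. 0) = of_nat 0 * x" by (simp add: fun_eq_iff)
  then have "peval (\<Sum>k\<le>d. Pk k) (\<lambda>_. 0) = (\<Sum>k\<le>d. 0 ^ k * peval (Pk k) x)"
    using peval_homogeneous[OF hom, where m=0 and x=x] by (simp add: peval_sum)
  also have "\<dots> = (\<Sum>k\<in>{0}. 0 ^ k * peval (Pk k) x)"
    by (rule sum.mono_neutral_right) (auto simp: power_0_left)
  finally show ?thesis by simp
qed

subsection \<open>Generalized eigenspaces\<close>

lemma ex1_unique: "\<exists>!x. P x \<Longrightarrow> P a \<Longrightarrow> P b \<Longrightarrow> a = b"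
  by auto

lemma funpow_commute_apply:
  assumes "\<And>x. g (f x) = f (g x)"
  shows "g ((f ^^ k) x) = (f ^^ k) (g x)"
  by (induction k) (simp_all add: assms)

lemma funpow_zero_mono:
  fixes f :: "'a::zero \<Rightarrow> 'a"
  assumes "(f ^^ k) a = 0" "f 0 = 0" "k \<le> l"
  shows "(f ^^ l) a = 0"
proof -
  have "(f ^^ j) 0 = 0" for j by (induction j) (simp_all add: assms(2))
  moreover have "f ^^ l = f ^^ (l - k) \<circ> f ^^ k" using assms(3) by (simp flip: funpow_add)
  ultimately show ?thesis using assms(1) by simp
qed

context module
begin

lemma module_hom_funpow: "module_hom scale scale f \<Longrightarrow> module_hom scale scale (f ^^ k)"
  by (induction k) (auto intro: module_hom_compose module_hom_id)

text \<open>The kernels of the powers increase, so their union is already a submodule and the span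
  adds nothing.\<close>

lemma sum_Ker_powers_iff:
  assumes f: "module_hom scale scale f"
  shows "a \<in> sum_Ker_powers scale f \<longleftrightarrow> (\<exists>k. (f ^^ k) a = 0)"
proof -
  interpret f: module_hom scale scale f by (fact f)
  interpret fp: module_hom scale scale "f ^^ k" for k by (intro module_hom_funpow f)
  have eq: "(\<Union>i\<in>{1..}. Ker (f ^^ i)) = {a. \<exists>k. (f ^^ k) a = 0}" (is "_ = ?K")
  proof (intro equalityI subsetI)
    fix a assume "a \<in> ?K"
    then obtain k where "(f ^^ k) a = 0" by blast
    \<comment> \<open>The union starts at exponent 1, so an exponent that may be 0 is raised by
      one.\<close>
    then have "(f ^^ Suc k) a = 0" by simp
    then show "a \<in> (\<Union>i\<in>{1..}. Ker (f ^^ i))"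
      unfolding Ker_def by (intro UN_I[of "Suc k"]) simp_all
  qed (auto simp: Ker_def)
  have "subspace ?K"
  proof (rule subspaceI)
    fix x y assume "x \<in> ?K" "y \<in> ?K"
    then obtain k l where "(f ^^ k) x = 0" "(f ^^ l) y = 0" by blast
    then have "(f ^^ max k l) x = 0" "(f ^^ max k l) y = 0"
      by (auto intro: funpow_zero_mono[of k f] funpow_zero_mono[of l f])
    then have "(f ^^ max k l) (x + y) = 0" by (simp add: fp.add)
    then show "x + y \<in> ?K" by blast
  next
    fix c x assume "x \<in> ?K"
    then obtain k where "(f ^^ k) x = 0" by blast
    then have "(f ^^ k) (c *s x) = 0" by (simp add: fp.scale)
    then show "c *s x \<in> ?K" by blast
  qed auto
  then have "sum_Ker_powers scale f = ?K"
    unfolding sum_Ker_powers_def eq by simp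
  then show ?thesis by simp
qed

lemma module_hom_shift:
  "module_hom scale scale f \<Longrightarrow> module_hom scale scale (\<lambda>a. f a - l *s a)"
  by (simp add: module_hom_iff algebra_simps)

lemma gen_eigenspace_iff:
  "module_hom scale scale f \<Longrightarrow>
    a \<in> gen_eigenspace scale f l \<longleftrightarrow> (\<exists>k. ((\<lambda>a. f a - l *s a) ^^ k) a = 0)"
  unfolding gen_eigenspace_def by (rule sum_Ker_powers_iff[OF module_hom_shift])

lemma subspace_gen_eigenspace: "subspace (gen_eigenspace scale f l)"
  unfolding gen_eigenspace_def sum_Ker_powers_def by simp

lemma gen_eigenspace_commuting_hom:
  assumes f: "module_hom scale scale f" and g: "module_hom scale scale g"
    and comm: "\<And>x. g (f x) = f (g x)" and a: "a \<in> gen_eigenspace scale f l"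
  shows "g a \<in> gen_eigenspace scale f l"
proof -
  interpret g: module_hom scale scale g by (fact g)
  obtain k where k: "((\<lambda>a. f a - l *s a) ^^ k) a = 0" using a gen_eigenspace_iff[OF f] by blast
  have "((\<lambda>a. f a - l *s a) ^^ k) (g a) = g (((\<lambda>a. f a - l *s a) ^^ k) a)"
    by (rule funpow_commute_apply[symmetric]) (simp add: g.diff g.scale comm)
  with k show ?thesis using gen_eigenspace_iff[OF f] by auto
qed

text \<open>Extended by zero, \<open>g\<close> is a decomposition of 0, as is the zero family;
  uniqueness in the direct sum makes them equal.\<close>

lemma gen_eigenspace_independent:
  assumes f: "module_hom scale scale f" and dec: "decomposable scale f"
    and S: "finite S" "\<And>l. l \<in> S \<Longrightarrow> g l \<in> gen_eigenspace scale f l" and sum: "(\<Sum>l\<in>S. g l) = 0"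
    and l: "l \<in> S"
  shows "g l = 0"
proof -
  define h where "h l = (if l \<in> S then g l else 0)" for l
  let ?dec = "\<lambda>h. finite {l. h l \<noteq> 0} \<and> (\<forall>l\<in>gen_eigenvalues scale f. h l \<in> gen_eigenspace scale f l) \<and>
    (\<forall>l. l \<notin> gen_eigenvalues scale f \<longrightarrow> h l = 0) \<and> 0 = (\<Sum>l\<in>{l. h l \<noteq> 0}. h l)"
  have uniq: "\<exists>!h. ?dec h"
    using dec unfolding decomposable_def is_direct_sum_def by blast
  have "?dec h"
  proof (intro conjI ballI allI impI)
    show "finite {l. h l \<noteq> 0}" by (rule finite_subset[OF _ S(1)]) (auto simp: h_def)
    show "h l \<in> gen_eigenspace scale f l" for l
      using S(2) subspace_0[OF subspace_gen_eigenspace] by (simp add: h_def)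
    \<comment> \<open>A nonzero \<open>h l\<close> killed by a power of the shifted map would make
      \<open>l\<close> an eigenvalue.\<close>
    show "h l = 0" if l: "l \<notin> gen_eigenvalues scale f" for l
    proof (rule ccontr)
      assume nz: "h l \<noteq> 0"
      then have "l \<in> S" by (auto simp: h_def split: if_splits)
      then obtain k where k: "((\<lambda>a. f a - l *s a) ^^ k) (h l) = 0"
        using S(2)[of l] gen_eigenspace_iff[OF f] by (auto simp: h_def)
      with nz have "k \<noteq> 0" by (intro notI) simp
      with nz k l show False unfolding gen_eigenvalues_def Ker_def
        by (metis (mono_tags, lifting) One_nat_def Suc_leI bot_nat_0.not_eq_extremum mem_Collect_eq)
    qed
    have "(\<Sum>l\<in>{l. h l \<noteq> 0}. h l) = (\<Sum>l\<in>S. g l)"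
      using S(1) by (intro sum.mono_neutral_cong_left) (auto simp: h_def)
    with sum show "0 = (\<Sum>l\<in>{l. h l \<noteq> 0}. h l)" by simp
  qed
  moreover have "?dec (\<lambda>_. 0)"
    using subspace_0[OF subspace_gen_eigenspace] by simp
  ultimately have "h = (\<lambda>_. 0)" by (rule ex1_unique[OF uniq])
  then show ?thesis using l by (auto simp: h_def dest: fun_cong[of _ _ l])
qed

lemma gen_eigenspace_decompose:
  assumes "decomposable scale f"
  obtains S g where "finite S" "\<And>l. l \<in> S \<Longrightarrow> g l \<in> gen_eigenspace scale f l" "a = (\<Sum>l\<in>S. g l)"
proof -
  obtain g where "finite {l. g l \<noteq> 0}" "\<forall>l\<in>gen_eigenvalues scale f. g l \<in> gen_eigenspace scale f l"
    "\<forall>l. l \<notin> gen_eigenvalues scale f \<longrightarrow> g l = 0" "a = (\<Sum>l\<in>{l. g l \<noteq> 0}. g l)"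
    using assms unfolding decomposable_def is_direct_sum_def by blast
  then show ?thesis by (intro that[of "{l. g l \<noteq> 0}" g]) blast+
qed

end

section \<open>Products of generalized eigenspaces of a derivation\<close>

context r_algebra
begin

text \<open>The shift of \<open>\<delta>\<close> by \<open>l + m\<close> obeys a Leibniz rule with
  the shifts by \<open>l\<close> and \<open>m\<close> on the two factors. By induction on
  \<open>p + q\<close>, if these shifts kill the factors after \<open>p\<close> and \<open>q\<close>
  applications, the product is killed after \<open>p + q\<close>.\<close>

lemma gen_eigenspace_mult:
  assumes der: "derivation scale \<delta>"
    and a: "a \<in> gen_eigenspace scale \<delta> l" and b: "b \<in> gen_eigenspace scale \<delta> m"
  shows "a * b \<in> gen_eigenspace scale \<delta> (l + m)"
proof -
  define sh where "sh l = (\<lambda>a. \<delta> a - scale l a)" for l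
  have hom: "module_hom scale scale \<delta>" and leib: "\<And>a b. \<delta> (a * b) = \<delta> a * b + a * \<delta> b"
    using der by (auto simp: derivation_def)
  interpret sh: module_hom scale scale "sh c ^^ k" for c k
    unfolding sh_def by (intro module_hom_funpow module_hom_shift hom)
  have sh_mult: "sh (l + m) (a * b) = sh l a * b + a * sh m b" for a b
    unfolding sh_def leib
    by (simp add: left_diff_distrib right_diff_distrib scale_left_distrib
        flip: scale_mult_left scale_mult_right)
  have zero: "(sh l ^^ p) a = 0 \<Longrightarrow> (sh m ^^ q) b = 0 \<Longrightarrow> (sh (l + m) ^^ (p + q)) (a * b) = 0" for p q a b
  proof (induction "p + q" arbitrary: p q a b)
    case 0
    then show ?case by simp
  next
    case (Suc s)
    show ?case
    proof (cases "p = 0 \<or> q = 0")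
      case True
      with Suc.prems have "a * b = 0" by auto
      then show ?thesis by (simp add: sh.zero)
    next
      case False
      then obtain p' q' where pq: "p = Suc p'" "q = Suc q'" by (metis not0_implies_Suc)
      have "(sh (l + m) ^^ (p' + q)) (sh l a * b) = 0"
        using Suc.prems Suc.hyps(2) pq by (intro Suc.hyps(1)) (simp_all add: funpow_swap1)
      moreover have "p + q' = p' + q" using pq by simp
      moreover have "(sh (l + m) ^^ (p + q')) (a * sh m b) = 0"
        using Suc.prems Suc.hyps(2) pq by (intro Suc.hyps(1)) (simp_all add: funpow_swap1)
      moreover have "(sh (l + m) ^^ (p + q)) (a * b) = (sh (l + m) ^^ (p' + q)) (sh l a * b + a * sh m b)"
        unfolding pq by (simp add: funpow_swap1 sh_mult)
      ultimately show ?thesis by (simp only: sh.add add_0)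
    qed
  qed
  have iff: "x \<in> gen_eigenspace scale \<delta> c \<longleftrightarrow> (\<exists>k. (sh c ^^ k) x = 0)" for x c
    unfolding sh_def by (rule gen_eigenspace_iff[OF hom])
  obtain p q where "(sh l ^^ p) a = 0" "(sh m ^^ q) b = 0" 
    using a b unfolding iff by blast
  then show ?thesis unfolding iff using zero by blast
qed

end

section \<open>The grading by joint generalized eigenspaces\<close>

locale commuting_decomposable_derivations = r_algebra scale
  for scale :: "'r::comm_ring_1 \<Rightarrow> 'a::ring \<Rightarrow> 'a" (infixr \<open>*s\<close> 75) +
  fixes n :: nat and D :: "nat \<Rightarrow> 'a \<Rightarrow> 'a"
  assumes derivation: "i < n \<Longrightarrow> derivation scale (D i)"
    and commute: "i < n \<Longrightarrow> j < n \<Longrightarrow> D i (D j a) = D j (D i a)"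
    and decomposable: "i < n \<Longrightarrow> decomposable scale (D i)"
begin

text \<open>A \<open>k\<close>-tuple is encoded as a function vanishing from \<open>k\<close> on, so
  that distinct weights differ in one of the first \<open>k\<close> coordinates. The parameter
  allows induction on the number of derivations.\<close>

definition weights :: "nat \<Rightarrow> (nat \<Rightarrow> 'r) set" where
  "weights k = {w. \<forall>i\<ge>k. w i = 0}"

definition weight_space :: "nat \<Rightarrow> (nat \<Rightarrow> 'r) \<Rightarrow> 'a set" where
  "weight_space k w = {a. \<forall>i<k. a \<in> gen_eigenspace scale (D i) (w i)}"

text \<open>With \<open>X\<close> the set of weights below a given one, this describes the
  lower-order terms of an element.\<close>

definition weight_sum :: "(nat \<Rightarrow> 'r) set \<Rightarrow> 'a set" where
  "weight_sum X = span (\<Union>w\<in>X. weight_space n w)"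

lemma hom_D: "i < n \<Longrightarrow> module_hom scale scale (D i)"
  using derivation by (simp add: derivation_def)

lemma subspace_weight_space: "subspace (weight_space k w)"
proof -
  have "weight_space k w = \<Inter> ((\<lambda>i. gen_eigenspace scale (D i) (w i)) ` {..<k})"
    by (auto simp: weight_space_def)
  then show ?thesis using subspace_gen_eigenspace by (auto intro: subspace_Int)
qed

lemma weight_space_commuting_hom:
  assumes "module_hom scale scale g" "\<And>i x. i < k \<Longrightarrow> g (D i x) = D i (g x)"
    and "a \<in> weight_space k w" "k \<le> n"
  shows "g a \<in> weight_space k w"
proof -
  have "g a \<in> gen_eigenspace scale (D i) (w i)" if i: "i < k" for i
  proof (rule gen_eigenspace_commuting_hom[where g = g and a = a])
    show "module_hom scale scale (D i)" using assms(4) i by (intro hom_D) simp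
    show "g (D i x) = D i (g x)" for x using assms(2) i .
    show "a \<in> gen_eigenspace scale (D i) (w i)" using assms(3) i by (simp add: weight_space_def)
  qed (fact assms(1))
  then show ?thesis by (simp add: weight_space_def)
qed

text \<open>The elements sent into the sum form a submodule containing each weight space involved.
  The intended map is \<open>P(D)\<close>.\<close>

lemma weight_sum_commuting_hom:
  assumes g: "module_hom scale scale g" and "\<And>i x. i < n \<Longrightarrow> g (D i x) = D i (g x)"
    and "a \<in> weight_sum X"
  shows "g a \<in> weight_sum X"
proof -
  interpret g: module_hom scale scale g by (fact g)
  have "g x \<in> weight_sum X" if "w \<in> X" "x \<in> weight_space n w" for w x
  proof -
    have "g x \<in> weight_space n w"
      by (rule weight_space_commuting_hom[where g = g and a = x]) (fact g assms(2) that(2) order_refl)+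
    then show ?thesis unfolding weight_sum_def using that(1) by (intro span_base UN_I)
  qed
  then have "(\<Union>w\<in>X. weight_space n w) \<subseteq> {a. g a \<in> weight_sum X}" by blast
  moreover have "subspace {a. g a \<in> weight_sum X}"
    unfolding weight_sum_def by (rule g.subspace_linear_preimage) simp
  ultimately have "span (\<Union>w\<in>X. weight_space n w) \<subseteq> {a. g a \<in> weight_sum X}"
    by (rule span_minimal)
  then show ?thesis using assms(3) unfolding weight_sum_def by blast
qed

text \<open>Coordinates are fixed one at a time. Grouping the terms that agree with \<open>v\<close>
  in the first \<open>k\<close> coordinates by coordinate \<open>k\<close> gives members of distinct
  generalized eigenspaces of \<open>D k\<close> with sum zero, so each group vanishes.\<close>

lemma sum_agreeing_weights_zero:
  assumes S: "finite S" "\<And>w. w \<in> S \<Longrightarrow> f w \<in> weight_space n w" and "(\<Sum>w\<in>S. f w) = 0" and "k \<le> n"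
  shows "(\<Sum>w\<in>{w\<in>S. \<forall>i<k. w i = v i}. f w) = 0"
  using \<open>k \<le> n\<close>
proof (induction k)
  case 0
  then show ?case using assms by simp
next
  case (Suc k)
  define S' where "S' = {w\<in>S. \<forall>i<k. w i = v i}"
  define g where "g l = (\<Sum>w\<in>{w\<in>S'. w k = l}. f w)" for l
  have fin: "finite S'" using S by (simp add: S'_def)
  have "(\<Sum>l\<in>(\<lambda>w. w k) ` S'. g l) = 0"
    using Suc sum.image_gen[OF fin, of f "\<lambda>w. w k"] by (simp add: g_def S'_def)
  moreover have "g l \<in> gen_eigenspace scale (D k) l" for l
    unfolding g_def
  proof (rule subspace_sum[OF subspace_gen_eigenspace])
    fix w assume "w \<in> {w\<in>S'. w k = l}"
    then show "f w \<in> gen_eigenspace scale (D k) l"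
      using S(2)[of w] Suc.prems by (auto simp: S'_def weight_space_def)
  qed
  ultimately have "g (v k) = 0" if "v k \<in> (\<lambda>w. w k) ` S'"
    using gen_eigenspace_independent[OF hom_D decomposable, of k] that fin Suc.prems
    by (meson Suc_le_eq finite_imageI)
  moreover have "g (v k) = 0" if "v k \<notin> (\<lambda>w. w k) ` S'"
  proof -
    have "{w\<in>S'. w k = v k} = {}" using that by (metis (mono_tags, lifting) empty_Collect_eq imageI)
    then show ?thesis by (simp only: g_def sum.empty)
  qed
  moreover have "{w\<in>S'. w k = v k} = {w\<in>S. \<forall>i<Suc k. w i = v i}"
    by (auto simp: S'_def less_Suc_eq)
  ultimately show ?case by (auto simp: g_def)
qed

text \<open>Elements of \<open>weights n\<close> that agree in the first \<open>n\<close>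
  coordinates are equal, so the partial sum belonging to \<open>w\<close> is \<open>f w\<close>
  alone.\<close>

lemma weight_spaces_independent:
  assumes "finite S" "S \<subseteq> weights n" "\<And>w. w \<in> S \<Longrightarrow> f w \<in> weight_space n w" "(\<Sum>w\<in>S. f w) = 0" "w \<in> S"
  shows "f w = 0"
proof -
  have "v = w" if "v \<in> S" "\<forall>i<n. v i = w i" for v
  proof
    fix i
    have "v \<in> weights n" "w \<in> weights n" using that(1) assms(2,5) by blast+
    then show "v i = w i" using that by (cases "i < n") (simp_all add: weights_def)
  qed
  then have "{v\<in>S. \<forall>i<n. v i = w i} = {w}" using \<open>w \<in> S\<close> by auto
  then show ?thesis using sum_agreeing_weights_zero[OF assms(1,3,4), of n w] by simp
qed

lemma weight_sum_explicit:
  assumes "a \<in> weight_sum X"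
  shows "\<exists>S f. finite S \<and> S \<subseteq> X \<and> (\<forall>w\<in>S. f w \<in> weight_space n w) \<and> a = (\<Sum>w\<in>S. f w)"
  using assms unfolding weight_sum_def
proof (induction rule: span_induct_alt)
  case base
  then show ?case by (intro exI[of _ "{}"]) simp
next
  case (step c x y)
  then obtain S f v where S: "finite S" "S \<subseteq> X" "\<forall>w\<in>S. f w \<in> weight_space n w" "y = (\<Sum>w\<in>S. f w)"
    and v: "v \<in> X" "x \<in> weight_space n v" by blast
  \<comment> \<open>This covers both the case that \<open>v\<close> already lies in \<open>S\<close>
    and the case that it is new; \<open>f\<close> is cut off outside \<open>S\<close>, where nothing
    is known about it.\<close>
  define g where "g w = (if w \<in> S then f w else 0) + (if w = v then c *s x else 0)" for w
  have "(\<Sum>w\<in>insert v S. if w \<in> S then f w else 0) = (\<Sum>w\<in>S. f w)"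
    using S(1) by (intro sum.mono_neutral_cong_right) auto
  then have "c *s x + y = (\<Sum>w\<in>insert v S. g w)"
    using S by (simp add: g_def sum.distrib sum.delta' add.commute del: sum.insert)
  moreover have "g w \<in> weight_space n w" if "w \<in> insert v S" for w
    unfolding g_def using S v
    by (auto intro!: subspace_add subspace_scale subspace_weight_space subspace_0)
  ultimately show ?case using S v by (intro exI[of _ "insert v S"] exI[of _ g]) auto
qed

text \<open>The difference of the two expansions of \<open>a\<close> is a vanishing sum over
  disjoint sets of weights, so by independence all its terms vanish.\<close>

lemma weight_sum_disjoint:
  assumes "X \<inter> Y = {}" "X \<subseteq> weights n" "Y \<subseteq> weights n" "a \<in> weight_sum X" "a \<in> weight_sum Y"
  shows "a = 0"
proof -
  obtain S f where S: "finite S" "S \<subseteq> X" "\<forall>w\<in>S. f w \<in> weight_space n w" "a = (\<Sum>w\<in>S. f w)"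
    using weight_sum_explicit[OF assms(4)] by blast
  obtain T g where T: "finite T" "T \<subseteq> Y" "\<forall>w\<in>T. g w \<in> weight_space n w" "a = (\<Sum>w\<in>T. g w)"
    using weight_sum_explicit[OF assms(5)] by blast
  define h where "h w = (if w \<in> S then f w else - g w)" for w
  have "(\<Sum>w\<in>S \<union> T. h w) = (\<Sum>w\<in>S. h w) + (\<Sum>w\<in>T. h w)"
    using S T assms(1) by (intro sum.union_disjoint) auto
  also have "(\<Sum>w\<in>S. h w) = a" by (simp add: h_def S(4))
  also have "(\<Sum>w\<in>T. h w) = - a"
    unfolding T(4) sum_negf[symmetric] using S(2) T(2) assms(1) by (intro sum.cong) (auto simp: h_def)
  finally have 0: "(\<Sum>w\<in>S \<union> T. h w) = 0" by simp
  have "h w = 0" if "w \<in> S" for w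
    by (rule weight_spaces_independent[OF _ _ _ 0])
      (use S T assms that in \<open>auto simp: h_def intro!: subspace_neg subspace_weight_space\<close>)
  then show ?thesis unfolding S(4) by (intro sum.neutral) (auto simp: h_def split: if_splits)
qed

lemma commute_shift_funpow:
  assumes "i < n" "j < n"
  shows "((\<lambda>a. D i a - l *s a) ^^ k) (D j a) = D j (((\<lambda>a. D i a - l *s a) ^^ k) a)"
proof -
  interpret module_hom scale scale "D j" by (rule hom_D[OF assms(2)])
  show ?thesis
    by (rule funpow_commute_apply[symmetric]) (simp add: diff scale commute assms)
qed

text \<open>Induction on the number \<open>k\<close> of derivations: each member of a weight space
  for the first \<open>k\<close> is decomposed further under \<open>D k\<close>.\<close>

lemma weight_sum_all: "a \<in> weight_sum (weights n)"
proof -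
  have "k \<le> n \<Longrightarrow> a \<in> span (\<Union>w\<in>weights k. weight_space k w)" for k
  proof (induction k)
    case 0
    have "0 \<in> weights 0" "a \<in> weight_space 0 0" by (auto simp: weights_def weight_space_def)
    then show ?case by (blast intro: span_base)
  next
    case (Suc k)
    let ?T = "span (\<Union>w\<in>weights (Suc k). weight_space (Suc k) w)"
    have "b \<in> ?T" if w: "w \<in> weights k" "b \<in> weight_space k w" for b w
    proof -
      obtain S g where S: "finite S" "\<And>l. l \<in> S \<Longrightarrow> g l \<in> gen_eigenspace scale (D k) l"
        "b = (\<Sum>l\<in>S. g l)"
        using gen_eigenspace_decompose[OF decomposable, of k b] Suc.prems by auto
      \<comment> \<open>A power of the shift of \<open>D i\<close> kills \<open>b\<close>. It
        commutes with \<open>D k\<close>, hence preserves the generalized eigenspaces of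
        \<open>D k\<close>, and independence makes it kill each component of
        \<open>b\<close>.\<close>
      have "g l \<in> gen_eigenspace scale (D i) (w i)" if l: "l \<in> S" and i: "i < k" for l i
      proof -
        let ?sh = "\<lambda>a. D i a - w i *s a"
        have hom: "module_hom scale scale (?sh ^^ p)" for p
          using i Suc.prems by (intro module_hom_funpow module_hom_shift hom_D) auto
        have "b \<in> gen_eigenspace scale (D i) (w i)" using w i by (auto simp: weight_space_def)
        then obtain p where p: "(?sh ^^ p) b = 0"
          using gen_eigenspace_iff[OF hom_D] i Suc.prems by auto
        interpret sh: module_hom scale scale "?sh ^^ p" by (rule hom)
        have "(\<Sum>l\<in>S. (?sh ^^ p) (g l)) = 0" using p unfolding S(3) sh.sum .
        moreover have "(?sh ^^ p) (g l) \<in> gen_eigenspace scale (D k) l" if "l \<in> S" for l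
          using i Suc.prems that
          by (intro gen_eigenspace_commuting_hom[OF hom_D hom] S commute_shift_funpow) auto
        ultimately have "(?sh ^^ p) (g l) = 0"
          using gen_eigenspace_independent[OF hom_D decomposable S(1), of k "\<lambda>l. (?sh ^^ p) (g l)" l]
            Suc.prems l by auto
        then show ?thesis using gen_eigenspace_iff[OF hom_D] i Suc.prems by auto
      qed
      then have "g l \<in> weight_space (Suc k) (w(k := l))" if "l \<in> S" for l
        using S(2)[OF that] that by (auto simp: weight_space_def less_Suc_eq)
      moreover have "w(k := l) \<in> weights (Suc k)" for l using w by (auto simp: weights_def)
      ultimately show ?thesis unfolding S(3) by (intro span_sum span_base) blast
    qed
    then have "(\<Union>w\<in>weights k. weight_space k w) \<subseteq> ?T" by blast
    then show ?case using Suc span_minimal[OF _ subspace_span] by (meson Suc_leD subsetD)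
  qed
  then show ?thesis unfolding weight_sum_def by simp
qed

lemma weight_space_mult:
  "a \<in> weight_space n v \<Longrightarrow> b \<in> weight_space n w \<Longrightarrow> a * b \<in> weight_space n (v + w)"
  by (auto simp: weight_space_def intro!: gen_eigenspace_mult derivation)

text \<open>By bilinearity the case of two weight vectors extends first in the right factor and then
  in the left.\<close>

lemma weight_sum_mult:
  assumes a: "a \<in> weight_sum X" and b: "b \<in> weight_sum Y"
    and XY: "\<And>v w. v \<in> X \<Longrightarrow> w \<in> Y \<Longrightarrow> v + w \<in> Z"
  shows "a * b \<in> weight_sum Z"
proof -
  have left: "subspace {x. x * y \<in> weight_sum Z}" for y
    unfolding weight_sum_def
    by (rule subspaceI)
      (auto simp: distrib_right span_zero scale_mult_left[symmetric] intro: span_add span_scale)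
  have right: "subspace {y. x * y \<in> weight_sum Z}" for x
    unfolding weight_sum_def
    by (rule subspaceI)
      (auto simp: distrib_left span_zero scale_mult_right[symmetric] intro: span_add span_scale)
  have "x * y \<in> weight_sum Z" if "v \<in> X" "x \<in> weight_space n v" "w \<in> Y" "y \<in> weight_space n w" for v w x y
    unfolding weight_sum_def using weight_space_mult[OF that(2,4)] XY[OF that(1,3)]
    by (intro span_base) blast
  then have "weight_sum Y \<subseteq> {y. x * y \<in> weight_sum Z}" if "v \<in> X" "x \<in> weight_space n v" for x v
    unfolding weight_sum_def[of Y] using that by (intro span_minimal right) blast
  then have "weight_sum X \<subseteq> {x. x * b \<in> weight_sum Z}"
    unfolding weight_sum_def[of X] using b by (intro span_minimal left) blast
  with a show ?thesis by blast
qed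

end

subsection \<open>Extreme weights and the radical of the kernel\<close>

lemma reduced_ppow_nonzero:
  assumes "reduced TYPE('a::ring)" "(a::'a) \<noteq> 0" "m \<ge> 1"
  shows "ppow a m \<noteq> 0"
  using assms unfolding reduced_def by blast

text \<open>Includes the dummy exponent 0, for which \<open>ppow\<close> returns its base.\<close>

lemma ppow_zero: "ppow (0::'a::ring) m = 0"
  by (cases "m - 1") (simp_all add: ppow_def)

section \<open>The action of \<open>P(D)\<close> on weight spaces, and leading terms of
  powers\<close>

context commuting_decomposable_derivations
begin

lemma hom_monomial:
  assumes "set is \<subseteq> {..<n}"
  shows "module_hom scale scale (foldr (\<lambda>i. D i ^^ e i) is)"
  using assms
proof (induction "is")
  case Nil
  then show ?case by (simp add: id_def module_hom_ident)
next
  case (Cons i "is")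
  then show ?case
    by (simp add: module_hom_compose module_hom_funpow hom_D del: comp_apply)
qed

lemma commute_monomial:
  assumes "set is \<subseteq> {..<n}" "j < n"
  shows "foldr (\<lambda>i. D i ^^ e i) is (D j a) = D j (foldr (\<lambda>i. D i ^^ e i) is a)"
  using assms
proof (induction "is")
  case (Cons i "is")
  then show ?case
    using funpow_commute_apply[of "D j" "D i" "e i"] by (simp add: commute)
qed simp

lemma hom_diff_op: "module_hom scale scale (diff_op scale n P D)"
proof -
  interpret mon: module_hom scale scale "foldr (\<lambda>i. D i ^^ e i) [0..<n]" for e
    by (rule hom_monomial) auto
  show ?thesis
    unfolding module_hom_iff diff_op_def using module_axioms
    by (simp add: mon.add mon.scale scale_right_distrib sum.distrib scale_sum_right mult.commute)
qed

lemma commute_diff_op: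
  assumes "j < n"
  shows "diff_op scale n P D (D j a) = D j (diff_op scale n P D a)"
proof -
  interpret Dj: module_hom scale scale "D j" by (rule hom_D[OF assms])
  have "foldr (\<lambda>i. D i ^^ e i) [0..<n] (D j a) = D j (foldr (\<lambda>i. D i ^^ e i) [0..<n] a)" for e
    using assms by (intro commute_monomial) auto
  then show ?thesis by (simp add: diff_op_def Dj.sum Dj.scale)
qed

lemma weight_sum_diff_op:
  assumes "a \<in> weight_sum X"
  shows "diff_op scale n P D a \<in> weight_sum X"
  by (rule weight_sum_commuting_hom[where g = "diff_op scale n P D" and a = a])
    (fact hom_diff_op commute_diff_op assms)+

text \<open>In the induction step \<open>D k\<close> acts first; the scalar it produces passes
  through the linear monomial in the preceding derivations.\<close>

lemma monomial_eigenvector: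
  assumes "k \<le> n" "\<And>i. i < k \<Longrightarrow> D i a = w i *s a"
  shows "foldr (\<lambda>i. D i ^^ e i) [0..<k] a = (\<Prod>i<k. w i ^ e i) *s a"
  using assms
proof (induction k)
  case 0
  then show ?case by simp
next
  case (Suc k)
  interpret Dk: module_hom scale scale "D k" using Suc.prems by (intro hom_D) simp
  interpret mon: module_hom scale scale "foldr (\<lambda>i. D i ^^ e i) [0..<k]"
    using Suc.prems by (intro hom_monomial) auto
  have "(D k ^^ p) a = w k ^ p *s a" for p
    by (induction p) (use Suc.prems in \<open>simp_all add: Dk.scale mult.commute\<close>)
  then show ?case using Suc by (simp add: mon.scale mult.commute)
qed

lemma diff_op_eigenvector:
  assumes "P \<in> polys n" "\<And>i. i < n \<Longrightarrow> D i a = w i *s a"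
  shows "diff_op scale n P D a = peval P w *s a"
  unfolding diff_op_def peval_polys[OF assms(1)] scale_sum_left
  by (intro sum.cong refl) (simp add: monomial_eigenvector[OF _ assms(2)])

text \<open>Applying \<open>D k - w k\<close> as often as possible without reaching \<open>0\<close> turns an element
  of the weight space into an eigenvector of \<open>D k\<close>.\<close>

lemma Ker_diff_op_eigenvector:
  assumes "u \<in> weight_space n w" "diff_op scale n P D u = 0" "u \<noteq> 0" "k \<le> n"
  shows "\<exists>v. v \<noteq> 0 \<and> v \<in> weight_space n w \<and> diff_op scale n P D v = 0 \<and> (\<forall>i<k. D i v = w i *s v)"
  using \<open>k \<le> n\<close>
proof (induction k)
  case 0
  then show ?case using assms by blast
next
  case (Suc k)
  then obtain v where v: "v \<noteq> 0" "v \<in> weight_space n w" "diff_op scale n P D v = 0"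
    "\<And>i. i < k \<Longrightarrow> D i v = w i *s v" by auto
  define sh where "sh = (\<lambda>a. D k a - w k *s a)"
  have k: "k < n" using Suc.prems by simp
  interpret sh: module_hom scale scale "sh ^^ p" for p
    unfolding sh_def by (intro module_hom_funpow module_hom_shift hom_D k)
  interpret PD: module_hom scale scale "diff_op scale n P D" by (rule hom_diff_op)
  \<comment> \<open>Because the iterates commute with every \<open>D j\<close>, they preserve the
    weight space and the eigenvector equations obtained so far.\<close>
  have comm: "(sh ^^ p) (D j x) = D j ((sh ^^ p) x)" if "j < n" for p j x
    unfolding sh_def by (rule commute_shift_funpow[OF k that])
  have ex: "\<exists>p. (sh ^^ p) v = 0"
    using v(2) k gen_eigenspace_iff[OF hom_D[OF k]] by (auto simp: weight_space_def sh_def)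
  define p where "p = (LEAST p. (sh ^^ p) v = 0)"
  have p: "(sh ^^ p) v = 0" unfolding p_def using ex by (rule LeastI_ex)
  with v(1) have "p \<noteq> 0" by (intro notI) simp
  then obtain q where q: "p = Suc q" using not0_implies_Suc by blast
  define x where "x = (sh ^^ q) v"
  have "x \<noteq> 0" using not_less_Least[of q "\<lambda>p. (sh ^^ p) v = 0"] q by (auto simp: x_def p_def)
  moreover have "x \<in> weight_space n w"
    unfolding x_def
    by (rule weight_space_commuting_hom[where g = "sh ^^ q" and a = v])
      (fact sh.module_hom_axioms comm v(2) order_refl)+
  moreover have "diff_op scale n P D x = (sh ^^ q) (diff_op scale n P D v)"
    unfolding x_def by (rule funpow_commute_apply) (simp add: sh_def PD.diff PD.scale commute_diff_op k)
  then have "diff_op scale n P D x = 0" by (simp add: v sh.zero)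
  moreover have "D i x = w i *s x" if "i < Suc k" for i
  proof (cases "i = k")
    case True
    then show ?thesis using p q by (simp add: x_def sh_def)
  next
    case False
    then have "i < k" using that by simp
    then show ?thesis using k comm[of i q v] v(4) by (simp add: x_def sh.scale)
  qed
  ultimately show ?case by blast
qed

text \<open>The kernel then contains a joint eigenvector of weight \<open>w\<close>, on which
  \<open>P(D)\<close> acts as the scalar \<open>peval P w\<close>; torsion-freeness of the module
  forces this scalar to be 0.\<close>

lemma peval_zero_of_Ker:
  assumes "torsion_free_module scale" "P \<in> polys n"
    and "u \<in> weight_space n w" "diff_op scale n P D u = 0" "u \<noteq> 0"
  shows "peval P w = 0"
proof -
  obtain v where "v \<noteq> 0" "diff_op scale n P D v = 0" "\<forall>i<n. D i v = w i *s v"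
    using Ker_diff_op_eigenvector[OF assms(3-5) order_refl] by blast
  then have "v \<noteq> 0" "peval P w *s v = 0" using diff_op_eigenvector[OF assms(2), of v w] by simp_all
  then show ?thesis using assms(1) unfolding torsion_free_module_def by blast
qed

text \<open>\<open>b\<close> plays the role of the leading component of \<open>a\<close>, and a
  difference in \<open>C - {0}\<close> means a strictly lower weight. Multiplying by a lower-order
  factor keeps a product strictly below the leading weight.\<close>

lemma ppow_leading_weight:
  assumes C: "pointed_cone C" and w: "w \<in> weights n" and b: "b \<in> weight_space n w"
    and ab: "a - b \<in> weight_sum {v\<in>weights n. w - v \<in> C - {0}}" and "m \<ge> 1"
  shows "ppow b m \<in> weight_space n (of_nat m * w) \<and>
    ppow a m - ppow b m \<in> weight_sum {v\<in>weights n. of_nat m * w - v \<in> C - {0}}"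
  using \<open>m \<ge> 1\<close>
proof (induction m rule: dec_induct)
  case base
  show ?case using b ab unfolding ppow_1 of_nat_1 mult_1_left by (rule conjI)
next
  case (step m)
  define below where "below u = {v\<in>weights n. u - v \<in> C - {0}}" for u
  \<comment> \<open>Strict inequalities add up to a strict one, because \<open>C\<close> is
    pointed.\<close>
  have pos_add: "x + y \<in> C - {0}" if "x \<in> C - {0}" "y \<in> C - {0}" for x y
  proof -
    have "x + y \<noteq> 0"
    proof
      assume "x + y = 0"
      then have "- x = y" by (rule minus_unique)
      then show False using that pointed_coneD(3)[OF C, of x] by simp
    qed
    then show ?thesis using that pointed_coneD(2)[OF C] by blast
  qed
  have weights_add: "x + y \<in> weights n" if "x \<in> weights n" "y \<in> weights n" for x y
    using that by (simp add: weights_def)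
  have wm: "of_nat m * w \<in> weights n" using w by (simp add: weights_def)
  have B: "ppow b m \<in> weight_space n (of_nat m * w)"
    and AB: "ppow a m - ppow b m \<in> weight_sum (below (of_nat m * w))"
    using step.IH unfolding below_def by blast+
  have bb: "x \<in> weight_sum {u}" if "x \<in> weight_space n u" for x u
    using that unfolding weight_sum_def by (intro span_base) simp
  let ?T = "weight_sum (below (w + of_nat m * w))"
  have "(a - b) * (ppow a m - ppow b m) \<in> ?T"
  proof (rule weight_sum_mult)
    show "a - b \<in> weight_sum (below w)" using ab by (simp add: below_def)
    fix x y assume xy: "x \<in> below w" "y \<in> below (of_nat m * w)"
    have "(w - x) + (of_nat m * w - y) \<in> C - {0}"
      using xy unfolding below_def by (intro pos_add) blast+
    then have "w + of_nat m * w - (x + y) \<in> C - {0}" by (simp only: add_diff_add)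
    then show "x + y \<in> below (w + of_nat m * w)"
      using xy weights_add unfolding below_def by blast
  qed (fact AB)
  moreover have "(a - b) * ppow b m \<in> ?T"
  proof (rule weight_sum_mult)
    show "a - b \<in> weight_sum (below w)" using ab by (simp add: below_def)
    show "ppow b m \<in> weight_sum {of_nat m * w}" using B by (rule bb)
    fix x y assume "x \<in> below w" "y \<in> {of_nat m * w}"
    then show "x + y \<in> below (w + of_nat m * w)"
      using weights_add wm by (auto simp: below_def)
  qed
  moreover have "b * (ppow a m - ppow b m) \<in> ?T"
  proof (rule weight_sum_mult)
    show "b \<in> weight_sum {w}" using b by (rule bb)
    fix x y assume "x \<in> {w}" "y \<in> below (of_nat m * w)"
    then show "x + y \<in> below (w + of_nat m * w)"
      using weights_add w by (auto simp: below_def)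
  qed (fact AB)
  \<comment> \<open>The expansion keeps the order of the factors, as the algebra need not be
    commutative; every term contains a lower-order difference.\<close>
  moreover have "a * ppow a m - b * ppow b m =
      (a - b) * (ppow a m - ppow b m) + (a - b) * ppow b m + b * (ppow a m - ppow b m)"
    by (simp add: algebra_simps)
  ultimately have "a * ppow a m - b * ppow b m \<in> ?T"
    unfolding weight_sum_def by (simp only: span_add)
  moreover have "b * ppow b m \<in> weight_space n (w + of_nat m * w)"
    using weight_space_mult[OF b B] .
  ultimately show ?case
    unfolding ppow_Suc[OF step.hyps(1)] of_nat_Suc distrib_right mult_1_left below_def by blast
qed

text \<open>\<open>P(D)\<close> preserves weights, so killing \<open>ppow a m\<close> it also kills
  the leading part \<open>ppow (f w) m\<close>. This is nonzero because the algebra is reduced, so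
  \<open>peval_zero_of_Ker\<close> applies at its weight.\<close>

lemma leading_weight_zero:
  assumes red: "reduced TYPE('a)" and tf: "torsion_free_module scale" and P: "P \<in> polys n"
    and C: "pointed_cone C" and S: "finite S" "S \<subseteq> weights n"
      "\<And>v. v \<in> S \<Longrightarrow> f v \<in> weight_space n v" "a = (\<Sum>v\<in>S. f v)"
    and w: "w \<in> S" "f w \<noteq> 0" "\<And>v. v \<in> S \<Longrightarrow> w - v \<in> C"
    and m: "m \<ge> 1" "diff_op scale n P D (ppow a m) = 0"
  shows "peval P (of_nat m * w) = 0"
proof -
  define below where "below u = {v\<in>weights n. u - v \<in> C - {0}}" for u
  let ?PD = "diff_op scale n P D" and ?u = "of_nat m * w"
  interpret PD: module_hom scale scale ?PD by (rule hom_diff_op)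
  have "a - f w = (\<Sum>v\<in>S - {w}. f v)" using S w by (simp add: sum.remove)
  also have "\<dots> \<in> weight_sum (below w)"
    unfolding weight_sum_def using S w by (intro span_sum span_base) (auto simp: below_def)
  finally have ab: "a - f w \<in> weight_sum (below w)" .
  have *: "ppow (f w) m \<in> weight_space n ?u"
    "ppow a m - ppow (f w) m \<in> weight_sum (below ?u)"
    using ppow_leading_weight[OF C _ S(3)[OF w(1)] _ m(1), of a] S w ab by (auto simp: below_def)
  have wt: "?u \<in> weights n" using S w by (auto simp: weights_def)
  \<comment> \<open>The image has weight \<open>?u\<close>, but it is also minus the image of the
    lower-order terms, so it lies in two sums over disjoint sets of weights.\<close>
  have "?PD (ppow (f w) m) = 0"
  proof (rule weight_sum_disjoint)
    show "{?u} \<inter> below ?u = {}" "{?u} \<subseteq> weights n" "below ?u \<subseteq> weights n"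
      using wt by (auto simp: below_def)
    have "ppow (f w) m \<in> weight_sum {?u}"
      using *(1) unfolding weight_sum_def by (intro span_base) simp
    then show "?PD (ppow (f w) m) \<in> weight_sum {?u}"
      by (rule weight_sum_diff_op)
    have "?PD (ppow a m - ppow (f w) m) \<in> weight_sum (below ?u)"
      using *(2) by (rule weight_sum_diff_op)
    then have "- ?PD (ppow (f w) m) \<in> weight_sum (below ?u)" by (simp add: PD.diff m)
    then show "?PD (ppow (f w) m) \<in> weight_sum (below ?u)"
      using span_neg unfolding weight_sum_def by fastforce
  qed
  moreover have "ppow (f w) m \<noteq> 0" by (rule reduced_ppow_nonzero[OF red w(2) m(1)])
  ultimately show ?thesis by (intro peval_zero_of_Ker[OF tf P *(1)])
qed

text \<open>The two weights are the greatest and the least element of the support of \<open>a\<close> for a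
  translation-invariant total order.\<close>

lemma radical_Ker_extreme_weights:
  assumes tfg: "torsion_free_group TYPE('r)" and red: "reduced TYPE('a)"
    and tf: "torsion_free_module scale" and P: "P \<in> polys n"
    and a: "a \<in> radical (Ker (diff_op scale n P D))" "a \<noteq> 0"
  obtains N v w where "v \<in> weights n" "\<And>m. m \<ge> N \<Longrightarrow> peval P (of_nat m * v) = 0"
    "w \<in> weights n" "\<And>m. m \<ge> N \<Longrightarrow> peval P (of_nat m * w) = 0"
    "v = 0 \<Longrightarrow> w = 0 \<Longrightarrow> a \<in> weight_space n 0"
proof -
  obtain T f where T: "finite T" "T \<subseteq> weights n" "\<forall>v\<in>T. f v \<in> weight_space n v" "a = (\<Sum>v\<in>T. f v)"
    using weight_sum_explicit[OF weight_sum_all[of a]] by blast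
  \<comment> \<open>Zero components are discarded, so that the components at the extreme weights are
    nonzero.\<close>
  define S where "S = {v\<in>T. f v \<noteq> 0}"
  have S: "finite S" "S \<subseteq> weights n" "\<And>v. v \<in> S \<Longrightarrow> f v \<in> weight_space n v" "a = (\<Sum>v\<in>S. f v)"
    using T by (auto simp: S_def intro: sum.mono_neutral_right)
  have "S \<noteq> {}" using S(4) a(2) by auto
  obtain C :: "(nat \<Rightarrow> 'r) set" where C: "pointed_cone C" "\<forall>x. x \<in> C \<or> - x \<in> C"
    using total_cone_exists[OF torsion_free_group_fun[OF tfg]] by blast
  have neg_add: "- x - y \<in> C" if "- x \<in> C" "- y \<in> C" for x y
    using pointed_coneD(2)[OF C(1) that] by simp
  \<comment> \<open>The cone of the opposite order, whose greatest element is the least one for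
    \<open>C\<close>.\<close>
  define C' where "C' = {x. - x \<in> C}"
  have C': "pointed_cone C'" "\<forall>x. x \<in> C' \<or> - x \<in> C'"
    using C pointed_coneD[OF C(1)] neg_add by (auto simp: C'_def pointed_cone_def)
  obtain v where v: "v \<in> S" "\<forall>x\<in>S. v - x \<in> C"
    using cone_max_exists[OF C S(1) \<open>S \<noteq> {}\<close>] by blast
  obtain w where w: "w \<in> S" "\<forall>x\<in>S. w - x \<in> C'"
    using cone_max_exists[OF C' S(1) \<open>S \<noteq> {}\<close>] by blast
  obtain N where N: "\<And>m. m \<ge> N \<Longrightarrow> diff_op scale n P D (ppow a m) = 0"
    using a(1) by (auto simp: radical_def Ker_def)
  have nz: "f v \<noteq> 0" "f w \<noteq> 0" using v w by (auto simp: S_def)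
  show ?thesis
  \<comment> \<open>\<open>Suc N\<close> keeps \<open>m\<close> positive, where \<open>ppow\<close>
    is a genuine power.\<close>
  proof (rule that[of v "Suc N" w])
    show "v \<in> weights n" "w \<in> weights n" using S v w by auto
    fix m assume "m \<ge> Suc N"
    then have m: "m \<ge> 1" "diff_op scale n P D (ppow a m) = 0" using N by auto
    show "peval P (of_nat m * v) = 0"
      using leading_weight_zero[OF red tf P C(1) S v(1) nz(1) _ m] v(2) by blast
    show "peval P (of_nat m * w) = 0"
      using leading_weight_zero[OF red tf P C'(1) S w(1) nz(2) _ m] w(2) by blast
  next
    assume "v = 0" "w = 0"
    \<comment> \<open>With both extreme weights 0, extremality puts \<open>- x\<close> and
      \<open>x\<close> in \<open>C\<close>.\<close>
    then have "x = 0" if "x \<in> S" for x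
      using v(2) w(2) that pointed_coneD(3)[OF C(1), of x] by (auto simp: C'_def)
    then have "S = {0}" using \<open>S \<noteq> {}\<close> by blast
    then show "a \<in> weight_space n 0" using S by simp
  qed
qed

end

section \<open>Deduction of both statements from the extreme weights\<close>

theorem theorem3p1:
  fixes scale :: "'r::comm_ring_1 \<Rightarrow> 'a::ring \<Rightarrow> 'a"
    and n d :: nat
    and D :: "nat \<Rightarrow> 'a \<Rightarrow> 'a"
    and P :: "'r mpoly"
    and Pk :: "nat \<Rightarrow> 'r mpoly"
  assumes "torsion_free_group TYPE('r)"
    and "r_algebra scale"
    and "reduced TYPE('a)"
    and "torsion_free_module scale"
    and "\<And>i. i < n \<Longrightarrow> derivation scale (D i)"
    and "\<And>i j. i < n \<Longrightarrow> j < n \<Longrightarrow> D i \<circ> D j = D j \<circ> D i"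
    and "\<And>i. i < n \<Longrightarrow> decomposable scale (D i)"
    and "P \<in> polys n"
    and "P \<noteq> 0"
    and "\<And>k. k \<le> d \<Longrightarrow> Pk k \<in> polys n"
    and "\<And>k. k \<le> d \<Longrightarrow> homogeneous k (Pk k)"
    and "P = (\<Sum>k\<le>d. Pk k)"
  shows "(peval P (\<lambda>_. 0) = 0 \<and>
          (\<nexists>x::nat \<Rightarrow> 'r. (\<exists>i<n. x i \<noteq> 0) \<and> (\<forall>k\<in>{1..d}. peval (Pk k) x = 0))
          \<longrightarrow> radical (Ker (diff_op scale n P D)) \<subseteq> (\<Inter>i<n. sum_Ker_powers scale (D i)))
       \<and> (peval P (\<lambda>_. 0) \<noteq> 0
          \<longrightarrow> radical (Ker (diff_op scale n P D)) = {0} \<and>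
              mathieu_subspace scale (Ker (diff_op scale n P D)))"
proof -
  interpret r_algebra scale by (fact assms(2))
  interpret commuting_decomposable_derivations scale n D
  proof
    fix i j a assume "i < n" "j < n"
    then show "D i (D j a) = D j (D i a)" using fun_cong[OF assms(6), of i j a] by simp
  qed (use assms in auto)
  let ?K = "Ker (diff_op scale n P D)"
  interpret PD: module_hom scale scale "diff_op scale n P D" by (rule hom_diff_op)
  have components: "peval (Pk k) x = 0"
    if "\<And>m. m \<ge> N \<Longrightarrow> peval P (of_nat m * x) = 0" "k \<le> d" for N x k
    using peval_eventually_zero_components[OF assms(1) assms(11), where N=N and x=x] that assms(12)
    by blast
  show ?thesis
  proof (intro conjI impI subsetI INT_I, elim conjE)
    fix a i
    assume nz: "\<nexists>x::nat \<Rightarrow> 'r. (\<exists>i<n. x i \<noteq> 0) \<and> (\<forall>k\<in>{1..d}. peval (Pk k) x = 0)"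
      and a: "a \<in> radical ?K" and i: "i \<in> {..<n}"
    show "a \<in> sum_Ker_powers scale (D i)"
    proof (cases "a = 0")
      case True
      then show ?thesis by (simp add: sum_Ker_powers_def span_zero)
    next
      case False
      \<comment> \<open>A nonzero coordinate below \<open>n\<close> would make \<open>x\<close> a
        forbidden common zero; the other coordinates of a weight vanish anyway.\<close>
      have zero: "x = 0" if "x \<in> weights n" "\<And>m. m \<ge> N \<Longrightarrow> peval P (of_nat m * x) = 0" for x N
      proof
        fix j
        have "\<forall>k\<in>{1..d}. peval (Pk k) x = 0" using components[OF that(2)] by auto
        then show "x j = 0 j" using nz that(1) by (cases "j < n") (auto simp: weights_def)
      qed
      obtain N v w where v: "v \<in> weights n" "\<And>m. m \<ge> N \<Longrightarrow> peval P (of_nat m * v) = 0"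
        and w: "w \<in> weights n" "\<And>m. m \<ge> N \<Longrightarrow> peval P (of_nat m * w) = 0"
        and "v = 0 \<Longrightarrow> w = 0 \<Longrightarrow> a \<in> weight_space n 0"
        by (rule radical_Ker_extreme_weights[OF assms(1,3,4,8) a False]) (rule that; assumption)
      then have "a \<in> weight_space n 0" using zero[OF v] zero[OF w] by simp
      \<comment> \<open>At weight 0 the shifted map is \<open>D i\<close> itself.\<close>
      then show ?thesis using i by (simp add: weight_space_def gen_eigenspace_def)
    qed
  next
    assume P0: "peval P (\<lambda>_. 0) \<noteq> 0"
    have "a = 0" if a: "a \<in> radical ?K" for a
    proof (rule ccontr)
      assume "a \<noteq> 0"
      obtain N v where "\<And>m. m \<ge> N \<Longrightarrow> peval P (of_nat m * v) = 0"
        by (rule radical_Ker_extreme_weights[OF assms(1,3,4,8) a \<open>a \<noteq> 0\<close>]) (rule that)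
      \<comment> \<open>\<open>Pk 0\<close> is constant with value \<open>P(0)\<close>, so its
        vanishing at a single extreme weight is a contradiction.\<close>
      then have "peval (Pk 0) v = 0" by (rule components) simp_all
      then show False using P0 peval_at_zero[OF assms(11), of d v] assms(12) by simp
    qed
    moreover have "0 \<in> radical ?K" by (simp add: radical_def ppow_zero Ker_def)
    ultimately show rad: "radical ?K = {0}" by blast
    have "subspace ?K" unfolding Ker_def by (rule PD.subspace_kernel)
    \<comment> \<open>The assumption on the powers puts \<open>a\<close> in the radical, so
      \<open>a = 0\<close> and every such product vanishes.\<close>
    moreover have "b * ppow a m * c \<in> ?K" if "\<forall>m\<ge>1. ppow a m \<in> ?K" for a b c m
    proof -
      have "a \<in> radical ?K" using that by (auto simp: radical_def)
      then have "a = 0" by (simp add: rad)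
      then show ?thesis by (simp add: ppow_zero Ker_def)
    qed
    ultimately show "mathieu_subspace scale ?K" unfolding mathieu_subspace_def by blast
  qed
qed

end
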